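(* Let $T$ be a tree with $\ell$ leaves and $h$ heavy edges. If $T$ is not a single vertex, then $$\ell-h-1\le P(T)\le \ell-1.$$
   Context: Graphs are finite and simple. A path covering of a graph $G$ is a set of vertex-disjoint paths of $G$ (a single vertex counts as a path) containing all the vertices of $G$; the path covering number $P(G)$ is the minimum number of paths in a path covering of $G$. A leaf is a vertex of degree $1$. A vertex is heavy if its degree is greater than $2$, and light otherwise. A heavy edge is an edge both of whose endpoints are heavy vertices. *)

theory Defs
  imports "Graph_Theory.Graph_Theory"
begin

text \<open>
  A finite simple graph is a \<open>pair_graph\<close>: a finite vertex set with a symmetric irreflexive set of
  arcs, so an undirected edge is a pair of opposite arcs \<open>(u, v)\<close>, \<open>(v, u)\<close>, and the degree of a
  vertex is its out-degree.
\<close>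

text \<open>
  The library constant \<^const>\<open>tree\<close> is about directed cycles and counts the closed walk \<open>u, v, u\<close> as
  a cycle, so no symmetric digraph with an edge satisfies it. The cycles of an undirected simple graph
  are the cycles of length at least 3.
\<close>

definition undirected_acyclic :: "'a pair_pre_digraph \<Rightarrow> bool" where
  "undirected_acyclic G \<longleftrightarrow> \<not> (\<exists>c. pre_digraph.cycle (with_proj G) c \<and> 3 \<le> length c)"

definition undirected_tree :: "'a pair_pre_digraph \<Rightarrow> bool" where
  "undirected_tree G \<longleftrightarrow> pair_graph G \<and> connected (with_proj G) \<and> undirected_acyclic G"

definition degree :: "'a pair_pre_digraph \<Rightarrow> 'a \<Rightarrow> nat" where
  "degree G v = out_degree (with_proj G) v"

definition leaves :: "'a pair_pre_digraph \<Rightarrow> 'a set" where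
  "leaves G = {v \<in> pverts G. degree G v = 1}"

definition heavy :: "'a pair_pre_digraph \<Rightarrow> 'a \<Rightarrow> bool" where
  "heavy G v \<longleftrightarrow> v \<in> pverts G \<and> degree G v > 2"

text \<open>Edges are taken as two-element sets, so that opposite arcs are counted once.\<close>

definition heavy_edges :: "'a pair_pre_digraph \<Rightarrow> 'a set set" where
  "heavy_edges G = {{u, v} | u v. (u, v) \<in> parcs G \<and> heavy G u \<and> heavy G v}"

text \<open>
  A path is given by the list of its vertices (\<^const>\<open>vpath\<close>: nonempty, distinct vertices, consecutive
  ones adjacent). A list and its reverse describe the same path, but disjointness keeps a covering
  from containing both unless they are equal, so the cardinality counts paths correctly.
\<close>

definition path_covering :: "'a pair_pre_digraph \<Rightarrow> 'a list set \<Rightarrow> bool" where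
  "path_covering G C \<longleftrightarrow>
     finite C \<and> (\<forall>p\<in>C. vpath p (with_proj G)) \<and>
     pairwise (\<lambda>p q. set p \<inter> set q = {}) C \<and> (\<Union>p\<in>C. set p) = pverts G"

definition path_covering_number :: "'a pair_pre_digraph \<Rightarrow> nat" where
  "path_covering_number G = (LEAST k. \<exists>C. path_covering G C \<and> card C = k)"

lemma path_covering_singletons:
  assumes "pair_graph G"
  shows "path_covering G ((\<lambda>v. [v]) ` pverts G)"
proof -
  interpret pair_graph G by fact
  show ?thesis
    using pair_finite_verts
    by (auto simp: path_covering_def vpath_def vwalk_def pairwise_def)
qed

lemma path_covering_number_attained:
  assumes "pair_graph G"
  shows "\<exists>C. path_covering G C \<and> card C = path_covering_number G"
  unfolding path_covering_number_def
  by (rule LeastI_ex) (use path_covering_singletons[OF assms] in blast)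

lemma path_covering_number_le:
  "path_covering G C \<Longrightarrow> path_covering_number G \<le> card C"
  unfolding path_covering_number_def by (rule Least_le) blast

end

theory Submission
  imports Defs
begin

text \<open>
  Let \<open>n\<close> be the number of vertices. A tree has \<open>n - 1\<close> edges, so \<open>\<ell> = 2 + (\<Sum>v heavy. deg v - 2)\<close>, and
  a covering by \<open>k\<close> paths uses \<open>n - k\<close> edges and omits \<open>k - 1\<close>. Since a vertex has at most two
  edges on its path, at least \<open>deg v - 2\<close> edges at each heavy vertex \<open>v\<close> are omitted, and only heavy
  edges are counted twice: \<open>\<ell> - 2 \<le> (k - 1) + h\<close>. Conversely, deleting \<open>deg v - 2\<close> edges at each
  heavy vertex removes at most \<open>\<ell> - 2\<close> edges and leaves a forest of maximum degree at most 2, which is a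
  disjoint union of at most \<open>\<ell> - 1\<close> paths.
\<close>

section \<open>Arcs of vertex lists\<close>

lemma map_fst_vwalk_arcs: "map fst (vwalk_arcs p) = butlast p"
  by (induction p rule: vwalk_arcs.induct) auto

lemma map_snd_vwalk_arcs: "map snd (vwalk_arcs p) = tl p"
  by (induction p rule: vwalk_arcs.induct) auto

lemma vwalk_arcs_fst_in: "(x, y) \<in> set (vwalk_arcs p) \<Longrightarrow> x \<in> set p"
  by (metis fst_conv image_eqI in_set_butlastD list.set_map map_fst_vwalk_arcs)

lemma vwalk_arcs_snd_in: "(x, y) \<in> set (vwalk_arcs p) \<Longrightarrow> y \<in> set p"
  by (metis snd_conv image_eqI list.set_map map_snd_vwalk_arcs list.sel(2) list.set_sel(2))

lemma distinct_map_fst_vwalk_arcs: "distinct p \<Longrightarrow> distinct (map fst (vwalk_arcs p))"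
  by (simp add: map_fst_vwalk_arcs distinct_butlast)

lemma distinct_map_snd_vwalk_arcs: "distinct p \<Longrightarrow> distinct (map snd (vwalk_arcs p))"
  by (simp add: map_snd_vwalk_arcs distinct_tl)

lemma vwalk_arcs_unique_succ:
  assumes "distinct p" "(x, y) \<in> set (vwalk_arcs p)" "(x, z) \<in> set (vwalk_arcs p)"
  shows "y = z"
  using eq_key_imp_eq_value[OF distinct_map_fst_vwalk_arcs[OF assms(1)] assms(2,3)] .

lemma vwalk_arcs_unique_pred:
  assumes "distinct p" "(x, z) \<in> set (vwalk_arcs p)" "(y, z) \<in> set (vwalk_arcs p)"
  shows "x = y"
proof -
  have "inj_on snd (set (vwalk_arcs p))"
    using distinct_map_snd_vwalk_arcs[OF assms(1)] by (simp add: distinct_map)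
  from inj_onD[OF this _ assms(2,3)] show ?thesis by simp
qed

lemma vwalk_arcs_asym:
  "distinct p \<Longrightarrow> (x, y) \<in> set (vwalk_arcs p) \<Longrightarrow> (y, x) \<notin> set (vwalk_arcs p)"
  by (induction p rule: vwalk_arcs.induct)
    (auto dest: vwalk_arcs_fst_in vwalk_arcs_snd_in)

lemma card_vwalk_arcs: "distinct p \<Longrightarrow> card (set (vwalk_arcs p)) = length p - 1"
  using distinct_map_fst_vwalk_arcs[of p] map_fst_vwalk_arcs[of p]
  by (metis distinct_card distinct_map length_butlast length_map)

lemma vwalk_arcs_pred_ex:
  assumes "u \<in> set p" "u \<noteq> hd p"
  shows "\<exists>a. (a, u) \<in> set (vwalk_arcs p)"
proof -
  have "u \<in> set (map snd (vwalk_arcs p))"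
    using assms by (cases p) (auto simp: map_snd_vwalk_arcs)
  then show ?thesis by auto
qed

lemma vwalk_arcs_succ_ex:
  assumes "u \<in> set p" "u \<noteq> last p"
  shows "\<exists>b. (u, b) \<in> set (vwalk_arcs p)"
proof -
  have "u \<in> set (map fst (vwalk_arcs p))"
    using assms by (cases p rule: rev_cases) (auto simp: map_fst_vwalk_arcs)
  then show ?thesis by auto
qed

lemma pcas_vwalk_arcs: "p \<noteq> [] \<Longrightarrow> pcas (hd p) (vwalk_arcs p) (last p)"
  by (induction p rule: vwalk_arcs.induct) auto

lemma pawalk_verts_vwalk_arcs: "p \<noteq> [] \<Longrightarrow> pawalk_verts (hd p) (vwalk_arcs p) = p"
  by (induction p rule: vwalk_arcs.induct) auto

text \<open>Links vertex lists to the cycles of \<open>undirected_acyclic\<close>. The lemma also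
  yields the closed walk \<open>u, v, u\<close>; the bound on the length enters only where it is
  applied.\<close>

lemma (in pair_graph) cycle_of_distinct_list:
  assumes "distinct p" "set (vwalk_arcs p) \<subseteq> parcs G" "p \<noteq> []" "(last p, hd p) \<in> parcs G"
  shows "cycle (vwalk_arcs (p @ [hd p]))"
proof -
  let ?q = "p @ [hd p]"
  have arcs: "set (vwalk_arcs ?q) \<subseteq> parcs G"
    using assms by (auto simp: vwalk_arcs_append)
  have hd: "hd ?q = hd p" using assms(3) by simp
  have "hd p \<in> pverts G" using assms(4) in_arcsD2 by blast
  then have "awalk (hd p) (vwalk_arcs ?q) (hd p)"
    using arcs pcas_vwalk_arcs[of ?q] hd by (simp add: awalk_def)
  \<comment> \<open>The closed walk visits \<open>p @ [hd p]\<close>, and the tail of this list is a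
    rotation of \<open>p\<close>.\<close>
  moreover have "distinct (tl (pawalk_verts (hd p) (vwalk_arcs ?q)))"
    using pawalk_verts_vwalk_arcs[of ?q] hd assms(1,3) by (cases p) auto
  moreover have "vwalk_arcs ?q \<noteq> []"
    using assms(3) by (simp add: vwalk_arcs_append)
  ultimately show ?thesis unfolding cycle_def by blast
qed

section \<open>Path covers\<close>

text \<open>Vertices and arcs are separate parameters because covers are needed in the tree and also
  in the forest \<open>F\<close> left after deleting edges.\<close>

definition path_cover :: "'a set \<Rightarrow> 'a rel \<Rightarrow> 'a list set \<Rightarrow> bool" where
  "path_cover V F C \<longleftrightarrow> finite C \<and>
     (\<forall>p\<in>C. p \<noteq> [] \<and> distinct p \<and> set (vwalk_arcs p) \<subseteq> F) \<and>
     pairwise (\<lambda>p q. set p \<inter> set q = {}) C \<and> (\<Union>p\<in>C. set p) = V"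

text \<open>Arcs are oriented as the lists traverse them, so each used edge occurs once; symmetric
  relations are compared with the union of this set and its converse.\<close>

definition cover_arcs :: "'a list set \<Rightarrow> 'a rel" where
  "cover_arcs C = (\<Union>p\<in>C. set (vwalk_arcs p))"

lemma path_covering_eq_path_cover:
  "path_covering G C \<longleftrightarrow> path_cover (pverts G) (parcs G) C"
  unfolding path_covering_def path_cover_def vpath_def vwalk_def by auto

lemma path_cover_mono: "path_cover V F C \<Longrightarrow> F \<subseteq> A \<Longrightarrow> path_cover V A C"
  unfolding path_cover_def by blast

lemma path_cover_singletons: "finite V \<Longrightarrow> path_cover V F ((\<lambda>v. [v]) ` V)"
  by (auto simp: path_cover_def pairwise_def)

context
  fixes V :: "'a set" and F :: "'a rel" and C :: "'a list set"
  assumes C: "path_cover V F C"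
begin

lemma finite_path_cover: "finite C"
  using C by (simp add: path_cover_def)

lemma path_cover_pathD:
  assumes "p \<in> C" shows "p \<noteq> []" "distinct p" "set (vwalk_arcs p) \<subseteq> F"
  using assms C by (auto simp: path_cover_def)

lemma path_cover_disjoint:
  "p \<in> C \<Longrightarrow> q \<in> C \<Longrightarrow> x \<in> set p \<Longrightarrow> x \<in> set q \<Longrightarrow> p = q"
  using C unfolding path_cover_def pairwise_def by blast

lemma path_cover_Union: "(\<Union>p\<in>C. set p) = V"
  using C by (simp add: path_cover_def)

lemma cover_arcs_subset: "cover_arcs C \<subseteq> F"
  using path_cover_pathD(3) by (auto simp: cover_arcs_def)

lemma finite_cover_arcs: "finite (cover_arcs C)"
  using finite_path_cover by (simp add: cover_arcs_def)

section \<open>Degrees and number of the arcs used by a cover\<close>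

lemma cover_arcs_unique_succ:
  "(x, y) \<in> cover_arcs C \<Longrightarrow> (x, z) \<in> cover_arcs C \<Longrightarrow> y = z"
  unfolding cover_arcs_def
  by (metis UN_E path_cover_disjoint path_cover_pathD(2) vwalk_arcs_fst_in vwalk_arcs_unique_succ)

lemma cover_arcs_unique_pred:
  "(x, z) \<in> cover_arcs C \<Longrightarrow> (y, z) \<in> cover_arcs C \<Longrightarrow> x = y"
  unfolding cover_arcs_def
  by (metis UN_E path_cover_disjoint path_cover_pathD(2) vwalk_arcs_snd_in vwalk_arcs_unique_pred)

lemma cover_arcs_asym: "(x, y) \<in> cover_arcs C \<Longrightarrow> (y, x) \<notin> cover_arcs C"
  unfolding cover_arcs_def
  by (metis UN_E path_cover_disjoint path_cover_pathD(2) vwalk_arcs_fst_in vwalk_arcs_snd_in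
      vwalk_arcs_asym)

text \<open>A path on m vertices has m - 1 arcs, and the paths partition \<open>V\<close>. The
  additive form avoids truncated subtraction.\<close>

lemma card_cover_arcs: "card (cover_arcs C) + card C = card V"
proof -
  have "card (cover_arcs C) = (\<Sum>p\<in>C. card (set (vwalk_arcs p)))"
    unfolding cover_arcs_def
  proof (rule card_UN_disjoint)
    show "\<forall>p\<in>C. \<forall>q\<in>C. p \<noteq> q \<longrightarrow> set (vwalk_arcs p) \<inter> set (vwalk_arcs q) = {}"
      by (auto dest: vwalk_arcs_fst_in intro: path_cover_disjoint)
  qed (simp_all add: finite_path_cover)
  also have "\<dots> = (\<Sum>p\<in>C. length p - 1)"
    by (intro sum.cong) (auto simp: card_vwalk_arcs path_cover_pathD)
  finally have "card (cover_arcs C) + card C = (\<Sum>p\<in>C. length p - 1 + 1)"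
    unfolding sum.distrib by simp
  also have "\<dots> = (\<Sum>p\<in>C. card (set p))"
  proof (intro sum.cong refl)
    fix p assume "p \<in> C"
    then show "length p - 1 + 1 = card (set p)"
      using path_cover_pathD[of p] by (cases p) (auto simp: distinct_card)
  qed
  also have "\<dots> = card V"
    unfolding path_cover_Union[symmetric]
    by (rule card_UN_disjoint[symmetric])
      (auto simp: finite_path_cover dest: path_cover_disjoint)
  finally show ?thesis .
qed

lemma card_cover_arcs_symcl: "card (cover_arcs C \<union> (cover_arcs C)\<inverse>) = 2 * card (cover_arcs C)"
proof -
  have "cover_arcs C \<inter> (cover_arcs C)\<inverse> = {}"
    using cover_arcs_asym by auto
  then show ?thesis
    using finite_cover_arcs by (simp add: card_Un_disjoint)
qed

text \<open>A vertex has at most one successor and at most one predecessor in the whole cover, since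
  only one path passes through it.\<close>

lemma card_cover_arcs_symcl_Image: "card ((cover_arcs C \<union> (cover_arcs C)\<inverse>) `` {v}) \<le> 2"
proof -
  have le1: "card S \<le> 1" if "\<And>x y. x \<in> S \<Longrightarrow> y \<in> S \<Longrightarrow> x = y" for S :: "'a set"
  proof (cases "S = {}")
    case False
    then obtain x where "x \<in> S" by blast
    then have "S \<subseteq> {x}" using that by blast
    then show ?thesis using card_mono[of "{x}" S] by simp
  qed simp
  have "card (cover_arcs C `` {v}) \<le> 1" "card ((cover_arcs C)\<inverse> `` {v}) \<le> 1"
    by (rule le1; auto dest: cover_arcs_unique_succ cover_arcs_unique_pred)+
  then show ?thesis
    using card_Un_le[of "cover_arcs C `` {v}" "(cover_arcs C)\<inverse> `` {v}"]
    by (simp add: Un_Image)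
qed

text \<open>Allowing each path to be reversed lets either end of \<open>p\<close> be linked to
  either end of \<open>q\<close>; symmetry of \<open>F\<close> keeps the reversed arcs in
  \<open>F\<close>.\<close>

lemma path_cover_join:
  assumes "p \<in> C" "q \<in> C" "p \<noteq> q"
    and p': "p' = p \<or> p' = rev p" and q': "q' = q \<or> q' = rev q"
    and "sym F" "(last p', hd q') \<in> F"
  shows "\<exists>C'. path_cover V F C' \<and> card C' < card C"
proof -
  let ?C = "insert (p' @ q') (C - {p, q})"
  have sets: "set p' = set p" "set q' = set q" using p' q' by auto
  have pq: "p \<noteq> []" "q \<noteq> []" "distinct p" "distinct q" "set p \<inter> set q = {}"
    using assms(1-3) path_cover_pathD path_cover_disjoint by blast+
  have rev: "set (vwalk_arcs (rev r)) \<subseteq> F" if "set (vwalk_arcs r) \<subseteq> F" for r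
    using that \<open>sym F\<close> by (auto simp: set_vwalk_arcs_rev dest: symD)
  have ne: "p' \<noteq> []" "q' \<noteq> []" using pq p' q' by auto
  have "set (vwalk_arcs p') \<subseteq> F" "set (vwalk_arcs q') \<subseteq> F"
    using p' q' rev path_cover_pathD(3) assms(1,2) by blast+
  then have arcs: "set (vwalk_arcs (p' @ q')) \<subseteq> F"
    using ne assms(7) by (simp add: vwalk_arcs_append)
  have dist: "distinct (p' @ q')" using pq p' q' by auto
  have "path_cover V F ?C"
    unfolding path_cover_def
  proof (intro conjI)
    show "finite ?C" using finite_path_cover by simp
    show "\<forall>r\<in>?C. r \<noteq> [] \<and> distinct r \<and> set (vwalk_arcs r) \<subseteq> F"
      using ne arcs dist path_cover_pathD by blast
    have "set r \<inter> (set p \<union> set q) = {}" if "r \<in> C - {p, q}" for r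
      using that assms(1,2) path_cover_disjoint by blast
    then show "pairwise (\<lambda>p q. set p \<inter> set q = {}) ?C"
      unfolding pairwise_insert
      using C sets by (auto simp: path_cover_def pairwise_def)
    have "(\<Union>r\<in>?C. set r) = (\<Union>r\<in>C. set r)"
      using assms(1,2) sets by auto
    then show "(\<Union>r\<in>?C. set r) = V" using path_cover_Union by simp
  qed
  moreover have "card ?C < card C"
  proof -
    \<comment> \<open>This makes \<open>card C\<close> at least 2, so the natural subtractions below
      do not truncate.\<close>
    have "card {p, q} \<le> card C"
      by (rule card_mono[OF finite_path_cover]) (use assms(1,2) in auto)
    moreover have "card (C - {p, q}) = card C - card {p, q}"
      by (rule card_Diff_subset) (use assms(1,2) in auto)
    moreover have "card {p, q} = 2" using \<open>p \<noteq> q\<close> by simp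
    ultimately show ?thesis
      using card_insert_le_m1[of "card C - 1" "C - {p, q}" "p' @ q'"] by linarith
  qed
  ultimately show ?thesis by blast
qed

lemma unused_arc_at_end:
  assumes "sym F" "card (F `` {u}) \<le> 2" "finite (F `` {u})" "(u, v) \<in> F" "p \<in> C" "u \<in> set p"
    and unused: "(u, v) \<notin> cover_arcs C" "(v, u) \<notin> cover_arcs C"
  shows "u = hd p \<or> u = last p"
proof (rule ccontr)
  assume "\<not> (u = hd p \<or> u = last p)"
  then obtain a b where ab: "(a, u) \<in> set (vwalk_arcs p)" "(u, b) \<in> set (vwalk_arcs p)"
    using vwalk_arcs_pred_ex vwalk_arcs_succ_ex assms(6) by metis
  then have "a \<noteq> b" using vwalk_arcs_asym path_cover_pathD(2) assms(5) by metis
  moreover have "a \<noteq> v" "b \<noteq> v" using ab unused assms(5) by (auto simp: cover_arcs_def)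
  ultimately have "card {a, b, v} = 3" by simp
  moreover have "{a, b, v} \<subseteq> F `` {u}"
    using ab path_cover_pathD(3)[OF assms(5)] assms(1,4) by (auto dest: symD)
  ultimately show False
    using card_mono[OF assms(3), of "{a, b, v}"] assms(2) by linarith
qed

end

section \<open>Counting in trees\<close>

text \<open>Connectedness is a cut condition, which directly supplies the next vertex when a subtree
  grows; acyclicity speaks of distinct lists, the form in which the paths of a cover are
  given.\<close>

locale finite_tree =
  fixes V :: "'a set" and A :: "'a rel"
  assumes finite_V: "finite V"
    and A_subset: "A \<subseteq> V \<times> V"
    and sym_A: "sym A"
    and irrefl_A: "(v, v) \<notin> A"
    and connected: "S \<subseteq> V \<Longrightarrow> S \<noteq> {} \<Longrightarrow> S \<noteq> V \<Longrightarrow> \<exists>s\<in>S. \<exists>w\<in>V - S. (s, w) \<in> A"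
    and acyclic: "distinct p \<Longrightarrow> set (vwalk_arcs p) \<subseteq> A \<Longrightarrow> 3 \<le> length p \<Longrightarrow> (last p, hd p) \<notin> A"
    and card_V: "2 \<le> card V"
begin

abbreviation deg :: "'a \<Rightarrow> nat" where "deg v \<equiv> card (A `` {v})"

lemma finite_A: "finite A"
  using finite_subset[OF A_subset] finite_V by blast

lemma finite_Image: "finite (A `` {v})"
  using finite_A by (metis finite_Image)

text \<open>A subtree grows one vertex at a time; acyclicity lets the new vertex have only one neighbour
  in it.\<close>

lemma ex_subtree:
  assumes "1 \<le> k" "k \<le> card V"
  shows "\<exists>S\<subseteq>V. card S = k \<and> card (A \<inter> S \<times> S) = 2 * (k - 1) \<and>
    (\<forall>x\<in>S. \<forall>y\<in>S. \<exists>p. p \<noteq> [] \<and> distinct p \<and> set p \<subseteq> S \<and> set (vwalk_arcs p) \<subseteq> A \<and>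
       hd p = x \<and> last p = y)"
  using assms
proof (induction k rule: dec_induct)
  case base
  obtain r where "r \<in> V" using card_V by fastforce
  then show ?case
    by (intro exI[of _ "{r}"]) (auto simp: irrefl_A intro!: exI[of _ "[r]"])
next
  case (step k)
  then obtain S where S: "S \<subseteq> V" "card S = k" "card (A \<inter> S \<times> S) = 2 * (k - 1)"
    and conn: "\<And>x y. x \<in> S \<Longrightarrow> y \<in> S \<Longrightarrow> \<exists>p. p \<noteq> [] \<and> distinct p \<and> set p \<subseteq> S \<and>
      set (vwalk_arcs p) \<subseteq> A \<and> hd p = x \<and> last p = y"
    by (metis Suc_leD)
  have fS: "finite S" using S(1) finite_V finite_subset by blast
  obtain s w where sw: "s \<in> S" "w \<in> V" "w \<notin> S" "(s, w) \<in> A"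
    using connected[OF S(1)] S(2) step by fastforce
  have "s \<noteq> w" using sw(1,3) by blast
  have ws: "(w, s) \<in> A" using sw(4) sym_A by (auto dest: symD)
  \<comment> \<open>A path inside \<open>S\<close> from \<open>s\<close> to a second neighbour
    \<open>t\<close> has at least two vertices, so prefixing \<open>w\<close> gives a list of length
    at least 3 that closes up to a forbidden cycle.\<close>
  have uniq: "t = s" if t: "t \<in> S" "(t, w) \<in> A" for t
  proof (rule ccontr)
    assume "t \<noteq> s"
    obtain p where p: "p \<noteq> []" "distinct p" "set p \<subseteq> S" "set (vwalk_arcs p) \<subseteq> A"
      "hd p = s" "last p = t" using conn[OF sw(1) t(1)] by blast
    have "2 \<le> length p" using p(1,5,6) \<open>t \<noteq> s\<close> by (cases p; cases "tl p") auto
    then have "(last (w # p), hd (w # p)) \<notin> A"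
      using p sw(3) ws by (intro acyclic) auto
    then show False using p t(2) by simp
  qed
  have uniq': "t = s" if "t \<in> S" "(w, t) \<in> A" for t
    using uniq[OF that(1)] that(2) sym_A by (auto dest: symD)
  \<comment> \<open>The new vertex brings exactly one edge, that is two arcs.\<close>
  have "A \<inter> insert w S \<times> insert w S = A \<inter> S \<times> S \<union> {(s, w), (w, s)}"
    using sw(1,4) ws uniq uniq' irrefl_A by blast
  moreover have "card (A \<inter> S \<times> S \<union> {(s, w), (w, s)}) = card (A \<inter> S \<times> S) + card {(s, w), (w, s)}"
    by (rule card_Un_disjoint) (use finite_A sw in auto)
  moreover have "card {(s, w), (w, s)} = 2" using \<open>s \<noteq> w\<close> by simp
  ultimately have card: "card (A \<inter> insert w S \<times> insert w S) = 2 * (Suc k - 1)"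
    using S(3) step(1) by simp
  have conn_w: "\<exists>p. p \<noteq> [] \<and> distinct p \<and> set p \<subseteq> insert w S \<and> set (vwalk_arcs p) \<subseteq> A \<and>
       hd p = x \<and> last p = y" if xy: "x \<in> insert w S" "y \<in> insert w S" for x y
  proof (cases "x = w")
    case x: True
    show ?thesis
    proof (cases "y = w")
      case True
      then show ?thesis using x by (intro exI[of _ "[w]"]) auto
    next
      case False
      then obtain p where "p \<noteq> []" "distinct p" "set p \<subseteq> S" "set (vwalk_arcs p) \<subseteq> A"
        "hd p = s" "last p = y" using conn[OF sw(1)] xy by blast
      then show ?thesis using x sw ws by (intro exI[of _ "w # p"]) auto
    qed
  next
    case x: False
    show ?thesis
    proof (cases "y = w")
      case True
      obtain p where "p \<noteq> []" "distinct p" "set p \<subseteq> S" "set (vwalk_arcs p) \<subseteq> A"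
        "hd p = x" "last p = s" using conn[OF _ sw(1)] xy x by blast
      then show ?thesis using True sw by (intro exI[of _ "p @ [w]"]) (auto simp: vwalk_arcs_append)
    next
      case False
      then show ?thesis using conn[of x y] x xy by blast
    qed
  qed
  show ?case
    using S sw fS card conn_w by (intro exI[of _ "insert w S"]) auto
qed

lemma card_A: "card A = 2 * (card V - 1)"
proof -
  obtain S where "S \<subseteq> V" "card S = card V" "card (A \<inter> S \<times> S) = 2 * (card V - 1)"
    using ex_subtree[of "card V"] card_V by auto
  moreover from this have "S = V" using card_subset_eq[OF finite_V] by blast
  moreover have "A \<inter> V \<times> V = A" using A_subset by blast
  ultimately show ?thesis by simp
qed

section \<open>Degree sums and the number of leaves\<close>

lemma card_eq_sum_Image:
  assumes "R \<subseteq> A"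
  shows "card (R \<inter> H \<times> UNIV) = (\<Sum>v\<in>V \<inter> H. card (R `` {v}))"
proof -
  have "R \<inter> H \<times> UNIV = Sigma (V \<inter> H) (\<lambda>v. R `` {v})" using assms A_subset by auto
  moreover have "finite (R `` {v})" for v
    using assms finite_A finite_subset finite_Image by (metis Image_mono order_refl)
  ultimately show ?thesis using finite_V by simp
qed

text \<open>The cut condition for \<open>{v}\<close> gives a neighbour, as \<open>{v}\<close> is not
  all of \<open>V\<close>.\<close>

lemma deg_pos:
  assumes "v \<in> V" shows "1 \<le> deg v"
proof -
  have "{v} \<noteq> V" using card_V by auto
  then have "A `` {v} \<noteq> {}" using connected[of "{v}"] assms by auto
  then show ?thesis using finite_Image[of v] by (simp add: Suc_leI card_gt_0_iff)
qed

lemma card_leaves: "card {v \<in> V. deg v = 1} = (\<Sum>v\<in>V. deg v - 2) + 2"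
proof -
  have "card A = (\<Sum>v\<in>V. deg v)"
    using card_eq_sum_Image[of A UNIV] by simp
  moreover have "card {v \<in> V. deg v = 1} = (\<Sum>v\<in>V. if deg v = 1 then 1 else 0)"
    using finite_V by (simp add: sum.If_cases Int_def)
  ultimately have "card A + card {v \<in> V. deg v = 1} = (\<Sum>v\<in>V. deg v + (if deg v = 1 then 1 else 0))"
    by (simp add: sum.distrib)
  \<comment> \<open>With truncated subtraction a leaf gives 1 + 1 = 0 + 2 and larger degrees agree
    plainly; degree 0 would break the identity and is excluded by \<open>deg_pos\<close>.\<close>
  also have "\<dots> = (\<Sum>v\<in>V. (deg v - 2) + 2)"
    by (intro sum.cong refl) (use deg_pos in force)
  also have "\<dots> = (\<Sum>v\<in>V. deg v - 2) + 2 * card V"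
    unfolding sum.distrib by simp
  finally show ?thesis using card_A card_V by simp
qed

section \<open>Omitted arcs and the lower bound\<close>

lemma card_arcs_le_twice_edges:
  assumes "B \<subseteq> A"
  shows "card B \<le> 2 * card {{u, v} | u v. (u, v) \<in> B}"
proof -
  let ?f = "\<lambda>(u, v). {u, v}"
  have E: "{{u, v} | u v. (u, v) \<in> B} = ?f ` B" by force
  have "finite B" using assms finite_A by (rule finite_subset)
  \<comment> \<open>Count arcs by the fibres of the map to edges; each fibre lies in
    \<open>{(a, b), (b, a)}\<close>.\<close>
  then have "card B = (\<Sum>e\<in>?f ` B. card {x \<in> B. ?f x = e})"
    using sum.image_gen[of B "\<lambda>_. 1::nat" ?f] by simp
  also have "\<dots> \<le> (\<Sum>e\<in>?f ` B. 2)"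
  proof (rule sum_mono)
    fix e assume "e \<in> ?f ` B"
    then obtain a b where e: "e = {a, b}" by (auto simp: case_prod_unfold)
    have "{x \<in> B. ?f x = e} \<subseteq> {(a, b), (b, a)}"
    proof
      fix x assume "x \<in> {x \<in> B. ?f x = e}"
      then have "{fst x, snd x} = {a, b}" using e by (simp add: case_prod_unfold)
      then show "x \<in> {(a, b), (b, a)}" unfolding doubleton_eq_iff by (cases x) auto
    qed
    then have "card {x \<in> B. ?f x = e} \<le> card {(a, b), (b, a)}"
      by (rule card_mono[rotated]) simp
    also have "\<dots> \<le> 2"
      using card_insert_le_m1[of 2 "{(b, a)}" "(a, b)"] by simp
    finally show "card {x \<in> B. ?f x = e} \<le> 2" .
  qed
  finally show ?thesis unfolding E by simp
qed

lemma path_cover_lower_bound: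
  assumes C: "path_cover V A C"
  defines "H \<equiv> {v. 2 < deg v}"
  shows "card {v \<in> V. deg v = 1} \<le> card C + card {{u, v} | u v. (u, v) \<in> A \<inter> H \<times> H} + 1"
proof -
  let ?U = "cover_arcs C \<union> (cover_arcs C)\<inverse>"
  let ?R = "A - ?U"
  let ?B = "?R \<inter> H \<times> UNIV"
  have U: "?U \<subseteq> A" using cover_arcs_subset[OF C] sym_A by (auto dest: symD)
  have symR: "(x, y) \<in> ?R \<Longrightarrow> (y, x) \<in> ?R" for x y using sym_A by (auto dest: symD)
  have fR: "finite ?R" using finite_A by simp
  have "card ?R = card A - card ?U"
    using U finite_A by (intro card_Diff_subset) (auto intro: finite_subset)
  \<comment> \<open>In other words, the omitted arcs \<open>?R\<close> number 2
    (\<open>card C\<close> - 1).\<close>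
  then have cardR: "card ?R + 2 * card V = card A + 2 * card C"
    using card_cover_arcs_symcl[OF C] card_cover_arcs[OF C] card_mono[OF finite_A U] by linarith
  \<comment> \<open>The truncated difference vanishes at light vertices.\<close>
  have "(\<Sum>v\<in>V. deg v - 2) = (\<Sum>v\<in>V \<inter> H. deg v - 2)"
    by (rule sum.mono_neutral_right) (auto simp: H_def finite_V)
  also have "\<dots> \<le> (\<Sum>v\<in>V \<inter> H. card (?R `` {v}))"
  proof (rule sum_mono)
    fix v
    have "?U `` {v} \<subseteq> A `` {v}" using U by blast
    then have "deg v - card (?U `` {v}) = card (A `` {v} - ?U `` {v})"
      using finite_Image[of v] by (metis card_Diff_subset finite_subset)
    also have "\<dots> \<le> card (?R `` {v})"
      using fR by (intro card_mono) (auto simp: Finite_Set.finite_Image)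
    finally show "deg v - 2 \<le> card (?R `` {v})"
      using card_cover_arcs_symcl_Image[OF C, of v] by linarith
  qed
  also have "\<dots> = card ?B" by (rule card_eq_sum_Image[symmetric]) auto
  finally have X: "(\<Sum>v\<in>V. deg v - 2) \<le> card ?B" .
  have fB: "finite ?B" using fR by simp
  \<comment> \<open>\<open>?B\<close> holds the omitted arcs with heavy tail. Adding converses stays
    within \<open>?R\<close>, and an arc counted twice has both ends heavy; this is where the heavy
    edges enter.\<close>
  have "2 * card ?B = card (?B \<union> ?B\<inverse>) + card (?B \<inter> ?B\<inverse>)"
    using card_Un_Int[of ?B "?B\<inverse>"] fB by simp
  also have "card (?B \<union> ?B\<inverse>) \<le> card ?R"
    using symR by (intro card_mono[OF fR]) auto
  also have "card (?B \<inter> ?B\<inverse>) \<le> card (A \<inter> H \<times> H)"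
    using finite_A by (intro card_mono) auto
  also have "card (A \<inter> H \<times> H) \<le> 2 * card {{u, v} | u v. (u, v) \<in> A \<inter> H \<times> H}"
    by (rule card_arcs_le_twice_edges) auto
  finally show ?thesis
    using X cardR card_A card_V card_leaves by linarith
qed

text \<open>An unused edge of \<open>F\<close> joins the ends of two paths of the cover, so a cover with the fewest
  paths uses every edge of \<open>F\<close>.\<close>

lemma ex_path_cover_symcl:
  assumes "F \<subseteq> A" "sym F" and deg: "\<And>v. card (F `` {v}) \<le> 2"
  shows "\<exists>C. path_cover V F C \<and> cover_arcs C \<union> (cover_arcs C)\<inverse> = F"
proof -
  obtain C where C: "path_cover V F C" and min: "\<And>C'. path_cover V F C' \<Longrightarrow> card C \<le> card C'"
    using ex_has_least_nat[of "path_cover V F" _ card] path_cover_singletons[OF finite_V] by metis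
  have fin: "finite (F `` {v})" for v
    using finite_Image[of v] assms(1) by (meson Image_mono finite_subset order_refl)
  have "(u, v) \<in> cover_arcs C \<union> (cover_arcs C)\<inverse>" if uv: "(u, v) \<in> F" for u v
  proof (rule ccontr)
    assume "(u, v) \<notin> cover_arcs C \<union> (cover_arcs C)\<inverse>"
    then have unused: "(u, v) \<notin> cover_arcs C" "(v, u) \<notin> cover_arcs C" by auto
    have vu: "(v, u) \<in> F" using uv assms(2) by (auto dest: symD)
    have "u \<in> V" "v \<in> V" "u \<noteq> v" using uv assms(1) A_subset irrefl_A by auto
    then obtain p q where p: "p \<in> C" "u \<in> set p" and q: "q \<in> C" "v \<in> set q"
      using path_cover_Union[OF C] by blast
    have u: "u = hd p \<or> u = last p"
      using unused_arc_at_end[OF C assms(2) deg fin uv p unused] .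
    have v: "v = hd q \<or> v = last q"
      using unused_arc_at_end[OF C assms(2) deg fin vu q unused(2,1)] .
    show False
    proof (cases "p = q")
      case True
      then have ends: "(last p, hd p) \<in> F" using u v uv vu \<open>u \<noteq> v\<close> by auto
      \<comment> \<open>A path of two vertices with ends \<open>u\<close> and \<open>v\<close> would
        use the edge, so \<open>p\<close> is longer and the edge closes a cycle.\<close>
      have "\<exists>a b. p = [a, b]" if "length p < 3"
        using that p q u v True \<open>u \<noteq> v\<close> by (cases p; cases "tl p") auto
      then have "3 \<le> length p"
        using unused p q u v True \<open>u \<noteq> v\<close> by (force simp: cover_arcs_def not_le[symmetric])
      then show False
        using acyclic[of p] path_cover_pathD[OF C p(1)] assms(1) ends by blast
    next
      case False
      \<comment> \<open>Orient the paths so that the first ends in \<open>u\<close> and the second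
        begins with \<open>v\<close>; joining them contradicts minimality.\<close>
      define p' where "p' = (if u = last p then p else rev p)"
      define q' where "q' = (if v = hd q then q else rev q)"
      have "last p' = u" "hd q' = v"
        using u v path_cover_pathD(1)[OF C p(1)] path_cover_pathD(1)[OF C q(1)]
        by (auto simp: p'_def q'_def last_rev hd_rev)
      then have "\<exists>C'. path_cover V F C' \<and> card C' < card C"
        using path_cover_join[OF C p(1) q(1) False, of p' q'] assms(2) uv
        by (auto simp: p'_def q'_def)
      then show False using min by (meson not_le)
    qed
  qed
  moreover have "cover_arcs C \<union> (cover_arcs C)\<inverse> \<subseteq> F"
    using cover_arcs_subset[OF C] assms(2) by (auto dest: symD)
  ultimately show ?thesis using C by (intro exI[of _ C]) auto
qed

section \<open>Deleting edges and the upper bound\<close>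

lemma path_cover_upper_bound: "\<exists>C. path_cover V A C \<and> card C + 1 \<le> card {v \<in> V. deg v = 1}"
proof -
  have "\<forall>v. \<exists>S\<subseteq>A `` {v}. card S = deg v - 2"
    by (meson diff_le_self obtain_subset_with_card_n)
  then obtain D where D: "\<And>v. D v \<subseteq> A `` {v}" "\<And>v. card (D v) = deg v - 2"
    by metis
  \<comment> \<open>\<open>D v\<close> selects the neighbours to cut off at \<open>v\<close>, none
    at a light vertex. Both directions are deleted so that \<open>F\<close> stays symmetric; two
    ends may select the same edge, so only an upper bound on the deletions is claimed.\<close>
  define R where "R = Sigma V D"
  define F where "F = A - (R \<union> R\<inverse>)"
  have finD: "finite (D v)" for v using D(1) finite_Image finite_subset by metis
  have cardR: "card R = (\<Sum>v\<in>V. deg v - 2)"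
    unfolding R_def using finite_V finD D(2) by simp
  have finR: "finite R" unfolding R_def using finite_V finD by simp
  have "sym F" using sym_A by (auto simp: F_def sym_def)
  moreover have "card (F `` {v}) \<le> 2" for v
  proof (cases "v \<in> V")
    case True
    have "card (F `` {v}) \<le> card (A `` {v} - D v)"
      using finite_Image True by (intro card_mono) (auto simp: F_def R_def)
    also have "\<dots> = deg v - (deg v - 2)"
      using D finD by (simp add: card_Diff_subset)
    finally show ?thesis by simp
  next
    case False
    then have "F `` {v} = {}" using A_subset by (auto simp: F_def)
    then show ?thesis by simp
  qed
  ultimately obtain C where C: "path_cover V F C" "cover_arcs C \<union> (cover_arcs C)\<inverse> = F"
    using ex_path_cover_symcl[of F] by (auto simp: F_def)
  have "card A - card (R \<union> R\<inverse>) \<le> card F"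
    unfolding F_def using finR by (intro diff_card_le_card_Diff) simp
  moreover have "card (R \<union> R\<inverse>) \<le> 2 * card R"
    using card_Un_le[of R "R\<inverse>"] by simp
  moreover have "card F = 2 * card (cover_arcs C)"
    using card_cover_arcs_symcl[OF C(1)] C(2) by simp
  \<comment> \<open>With n vertices and \<ell> leaves, 2 (n - 1) - 2 (\<ell> - 2) \<le>
    \<open>card F\<close> = 2 (n - \<open>card C\<close>).\<close>
  ultimately have "card C + 1 \<le> card {v \<in> V. deg v = 1}"
    using card_cover_arcs[OF C(1)] card_A card_V card_leaves cardR by linarith
  moreover have "path_cover V A C" using path_cover_mono[OF C(1)] by (auto simp: F_def)
  ultimately show ?thesis by blast
qed

end

section \<open>Path covering number of a tree\<close>

lemma degree_eq_card_Image: "degree G v = card (parcs G `` {v})"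
proof -
  have "out_arcs (with_proj G) v = Pair v ` (parcs G `` {v})"
    by (auto simp: out_arcs_def)
  then show ?thesis
    unfolding degree_def out_degree_def by (simp add: card_image inj_on_def)
qed

text \<open>In a symmetric graph, connectedness gives reachability between any two vertices. A
  vertex set without outgoing arcs is closed under reachability, which yields the cut
  condition.\<close>

lemma finite_tree_undirected_tree:
  assumes T: "undirected_tree T" and card: "card (pverts T) \<noteq> 1"
  shows "finite_tree (pverts T) (parcs T)"
proof -
  interpret pair_graph T using T by (simp add: undirected_tree_def)
  have sc: "strongly_connected (mk_symmetric T)"
    using T by (simp add: undirected_tree_def connected_def)
  have ne: "pverts T \<noteq> {}" using sc by (simp add: strongly_connected_def)
  have reach: "u \<rightarrow>\<^sup>*\<^bsub>T\<^esub> v" if "u \<in> pverts T" "v \<in> pverts T" for u v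
    using sc that reachable_mk_symmetric_eq[OF pair_sym_arcs]
    by (simp add: strongly_connected_def)
  show ?thesis
  proof
    show "finite (pverts T)" by (rule pair_finite_verts)
    show "parcs T \<subseteq> pverts T \<times> pverts T" using wellformed' by auto
    show "sym (parcs T)" using pair_sym_arcs by (simp add: symmetric_def)
    show "(v, v) \<notin> parcs T" for v using pair_no_loops by fastforce
    show "2 \<le> card (pverts T)"
      \<comment> \<open>Strong connectedness excludes the empty graph, so a number of vertices other
        than 1 is at least 2.\<close>
      using card ne pair_finite_verts card_gt_0_iff[of "pverts T"] by linarith
    show "(last p, hd p) \<notin> parcs T"
      if p: "distinct p" "set (vwalk_arcs p) \<subseteq> parcs T" "3 \<le> length p" for p
    proof
      assume "(last p, hd p) \<in> parcs T"
      then have "cycle (vwalk_arcs (p @ [hd p]))"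
        using p by (intro cycle_of_distinct_list) auto
      \<comment> \<open>Repeating the first vertex adds one arc, so the closed walk has as many arcs
        as \<open>p\<close> has vertices and the bound 3 carries over.\<close>
      moreover have "length (vwalk_arcs (p @ [hd p])) = length p"
        using vwalk_length_simp[of "p @ [hd p]", unfolded vwalk_length_def] by simp
      ultimately show False
        using T p(3) by (auto simp: undirected_tree_def undirected_acyclic_def)
    qed
    show "\<exists>s\<in>S. \<exists>w\<in>pverts T - S. (s, w) \<in> parcs T"
      if S: "S \<subseteq> pverts T" "S \<noteq> {}" "S \<noteq> pverts T" for S
    proof (rule ccontr)
      assume closed: "\<not> ?thesis"
      obtain s w where sw: "s \<in> S" "w \<in> pverts T" "w \<notin> S" using S by blast
      then have "s \<rightarrow>\<^sup>*\<^bsub>T\<^esub> w" using reach S by blast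
      then have "w \<in> S"
      proof (induction rule: reachable_induct)
        case base
        show ?case by (rule sw(1))
      next
        case (step x y)
        then show ?case using closed in_arcsD2 by auto
      qed
      then show False using sw by simp
    qed
  qed
qed

theorem theorem11:
  fixes T :: "'a pair_pre_digraph"
  assumes "undirected_tree T"
    and "card (pverts T) \<noteq> 1"
  shows "int (card (leaves T)) - int (card (heavy_edges T)) - 1 \<le> int (path_covering_number T)
    \<and> int (path_covering_number T) \<le> int (card (leaves T)) - 1"
proof -
  interpret finite_tree "pverts T" "parcs T"
    using finite_tree_undirected_tree[OF assms] .
  have leaves: "leaves T = {v \<in> pverts T. deg v = 1}"
    by (simp add: leaves_def degree_eq_card_Image)
  have heavy_edges: "heavy_edges T =
      {{u, v} | u v. (u, v) \<in> parcs T \<inter> {v. 2 < deg v} \<times> {v. 2 < deg v}}"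
    unfolding heavy_edges_def heavy_def degree_eq_card_Image using A_subset by blast
  have "pair_graph T" using assms(1) by (simp add: undirected_tree_def)
  \<comment> \<open>The lower bound holds for every cover and is applied to an optimal one; the
    upper bound compares the minimum with the constructed \<open>C'\<close>.\<close>
  then obtain C where C: "path_cover (pverts T) (parcs T) C" "card C = path_covering_number T"
    using path_covering_number_attained path_covering_eq_path_cover by metis
  obtain C' where C': "path_cover (pverts T) (parcs T) C'" "card C' + 1 \<le> card (leaves T)"
    using path_cover_upper_bound leaves by auto
  have "card (leaves T) \<le> path_covering_number T + card (heavy_edges T) + 1"
    using path_cover_lower_bound[OF C(1)] C(2) leaves heavy_edges by simp
  moreover have "path_covering_number T \<le> card C'"
    using C'(1) by (simp add: path_covering_number_le path_covering_eq_path_cover)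
  ultimately show ?thesis using C'(2) by linarith
qed

end
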